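(* For any graphs $G$ and $H$, $\nu_I(G\times H)\ge 2\,\nu_I(G)\,\nu_I(H)$. This bound is sharp, that is, there exist graphs $G$ and $H$ for which equality holds.
   Context: All graphs are finite and simple. A matching $M$ of a graph $G$ is an induced matching if no two distinct edges of $M$ are joined by an edge of $G$; $\nu_I(G)$ denotes the maximum cardinality of an induced matching in $G$. The direct product $G\times H$ has vertex set $V(G)\times V(H)$, and $(g,h)$, $(g',h')$ are adjacent if $gg'\in E(G)$ and $hh'\in E(H)$. *)

theory Defs
  imports "Graph_Theory.Pair_Digraph"
begin

text \<open>
  A finite simple graph is a \<^locale>\<open>pair_graph\<close>: finite vertex set, loop-free and symmetric
  adjacency relation \<^const>\<open>parcs\<close>. An undirected edge therefore occurs in \<^const>\<open>parcs\<close> as two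
  opposite arcs; matchings are sets of undirected edges, i.e. of two-element vertex sets, so that
  their cardinality does not count an edge twice.
\<close>

definition uedges :: "'a pair_pre_digraph \<Rightarrow> 'a set set" where
  "uedges G = {{u, v} | u v. (u, v) \<in> parcs G}"

definition matching :: "'a pair_pre_digraph \<Rightarrow> 'a set set \<Rightarrow> bool" where
  "matching G M \<longleftrightarrow> M \<subseteq> uedges G \<and> (\<forall>e\<in>M. \<forall>f\<in>M. e \<noteq> f \<longrightarrow> e \<inter> f = {})"

definition induced_matching :: "'a pair_pre_digraph \<Rightarrow> 'a set set \<Rightarrow> bool" where
  "induced_matching G M \<longleftrightarrow> matching G M \<and>
     (\<forall>e\<in>M. \<forall>f\<in>M. e \<noteq> f \<longrightarrow> \<not> (\<exists>u\<in>e. \<exists>v\<in>f. {u, v} \<in> uedges G))"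

definition induced_matching_number :: "'a pair_pre_digraph \<Rightarrow> nat" ("\<nu>\<^sub>I") where
  "\<nu>\<^sub>I G = Max {card M | M. induced_matching G M}"

definition direct_product ::
    "'a pair_pre_digraph \<Rightarrow> 'b pair_pre_digraph \<Rightarrow> ('a \<times> 'b) pair_pre_digraph"
    (infixl "\<times>\<^sub>d" 75) where
  "G \<times>\<^sub>d H =
     \<lparr> pverts = pverts G \<times> pverts H,
       parcs = {((g, h), (g', h')) | g h g' h'. (g, g') \<in> parcs G \<and> (h, h') \<in> parcs H} \<rparr>"

lemma pair_graph_direct_product:
  assumes "pair_graph G" "pair_graph H"
  shows "pair_graph (G \<times>\<^sub>d H)"
proof -
  interpret G: pair_graph G by fact
  interpret H: pair_graph H by fact
  have sub: "parcs (G \<times>\<^sub>d H) \<subseteq> (pverts G \<times> pverts H) \<times> (pverts G \<times> pverts H)"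
    by (auto simp: direct_product_def dest: G.wellformed' H.wellformed')
  have fin: "finite (pverts G \<times> pverts H)"
    using G.pair_finite_verts H.pair_finite_verts by blast
  have symG: "(b, a) \<in> parcs G" if "(a, b) \<in> parcs G" for a b
    using that G.pair_sym_arcs by (auto dest: arcs_ends_symmetric)
  have symH: "(b, a) \<in> parcs H" if "(a, b) \<in> parcs H" for a b
    using that H.pair_sym_arcs by (auto dest: arcs_ends_symmetric)
  show ?thesis
  proof unfold_locales
    show "finite (pverts (G \<times>\<^sub>d H))" using fin by (simp add: direct_product_def)
    show "finite (parcs (G \<times>\<^sub>d H))" using sub fin by (meson finite_SigmaI finite_subset)
    show "symmetric (with_proj (G \<times>\<^sub>d H))"
      by (auto simp: symmetric_def direct_product_def intro!: symI symG symH)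
  next
    fix e assume "e \<in> parcs (G \<times>\<^sub>d H)"
    then show "fst e \<in> pverts (G \<times>\<^sub>d H)" "snd e \<in> pverts (G \<times>\<^sub>d H)" "fst e \<noteq> snd e"
      using G.no_loops' by (auto simp: direct_product_def dest: G.wellformed' H.wellformed')
  qed
qed

text \<open>For a finite graph the maximum defining \<open>\<nu>\<^sub>I\<close> ranges over a finite nonempty set.\<close>

lemma finite_induced_matching_cards:
  assumes "pair_graph G"
  shows "finite {card M | M. induced_matching G M}"
proof -
  interpret pair_graph G by fact
  have "uedges G = (\<lambda>(u, v). {u, v}) ` parcs G"
    by (auto simp: uedges_def)
  then have "finite (uedges G)"
    using pair_finite_arcs by simp
  then have "finite {M. induced_matching G M}"
    by (rule finite_subset[rotated, OF finite_Pow_iff[THEN iffD2]])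
      (auto simp: induced_matching_def matching_def)
  then show ?thesis by simp
qed

lemma induced_matching_empty: "induced_matching G {}"
  by (simp add: induced_matching_def matching_def)

end

theory Submission
  imports Defs
begin

text \<open>
  Let \<open>M\<close> and \<open>N\<close> be maximum induced matchings of \<open>G\<close> and \<open>H\<close>. An edge of \<open>M\<close> and an edge of \<open>N\<close>
  together span two disjoint edges of the direct product, and all of these product edges form an
  induced matching: adjacent or equal vertices of the product have adjacent or equal
  coordinates, so both coordinates stay inside one edge of \<open>M\<close> and one edge of \<open>N\<close>. Counting arcs
  instead of edges gives the factor: \<open>(2 |M|) (2 |N|)\<close> arcs are \<open>2 |M| |N|\<close> edges. The bound is
  attained by \<open>K\<^sub>2 \<times> K\<^sub>2 = 2 K\<^sub>2\<close>.
\<close>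

text \<open>An unordered pair may come from either of its two arcs; symmetry of the arc relation
  makes the choice irrelevant.\<close>

lemma (in pair_graph) insert_mem_uedges_iff: "{u, v} \<in> uedges G \<longleftrightarrow> (u, v) \<in> parcs G"
  using pair_sym_arcs by (auto simp: uedges_def doubleton_eq_iff dest: arcs_ends_symmetric)

lemma (in pair_graph) singleton_notin_uedges: "{u} \<notin> uedges G"
  using insert_mem_uedges_iff[of u u] no_loops' by auto

text \<open>Disjointness and the absence of joining edges merge into one condition: equal or
  adjacent endpoints force equal edges. This form suits the direct product, since being equal or
  adjacent passes to both coordinates.\<close>

lemma induced_matching_iff:
  "induced_matching G M \<longleftrightarrow> M \<subseteq> uedges G \<and>
     (\<forall>u v u' v'. {u, v} \<in> M \<longrightarrow> {u', v'} \<in> M \<longrightarrow> u = u' \<or> {u, u'} \<in> uedges G \<longrightarrow>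
        {u, v} = {u', v'})"
  (is "_ \<longleftrightarrow> ?sub \<and> ?sep")
proof
  assume M: "induced_matching G M"
  have apart: "e \<inter> f = {} \<and> (\<forall>x\<in>e. \<forall>y\<in>f. {x, y} \<notin> uedges G)"
    if "e \<in> M" "f \<in> M" "e \<noteq> f" for e f
    using M that unfolding induced_matching_def matching_def by simp
  have "{u, v} = {u', v'}"
    if "{u, v} \<in> M" "{u', v'} \<in> M" "u = u' \<or> {u, u'} \<in> uedges G" for u v u' v'
    using apart[OF that(1,2)] that(3) by auto
  moreover have "M \<subseteq> uedges G"
    using M by (simp add: induced_matching_def matching_def)
  ultimately show "?sub \<and> ?sep" by simp
next
  assume M: "?sub \<and> ?sep"
  then have sub: ?sub and sep: ?sep by (rule conjunct1, rule conjunct2)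
  have joined: "e = f" if ef: "e \<in> M" "f \<in> M" "x \<in> e" "y \<in> f" and xy: "x = y \<or> {x, y} \<in> uedges G"
    for e f x y
  proof -
    \<comment> \<open>Any endpoint of an edge may be named first, so \<open>?sep\<close>, which
      compares first endpoints only, covers every choice of \<open>x\<close> and
      \<open>y\<close>.\<close>
    have other_end: "\<exists>z. d = {w, z}" if "d \<in> M" "w \<in> d" for d w
    proof -
      from sub that(1) obtain a b where "d = {a, b}" unfolding uedges_def by blast
      with that(2) show ?thesis by auto
    qed
    obtain v v' where ends: "e = {x, v}" "f = {y, v'}"
      using other_end[OF ef(1,3)] other_end[OF ef(2,4)] by blast
    have "{x, v} \<in> M" "{y, v'} \<in> M" using ef(1,2) ends by simp_all
    then have "{x, v} = {y, v'}" using sep xy by iprover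
    with ends show ?thesis by simp
  qed
  show "induced_matching G M"
    unfolding induced_matching_def matching_def
  proof (intro conjI ballI impI)
    show "M \<subseteq> uedges G" by (rule sub)
  next
    fix e f assume "e \<in> M" "f \<in> M" "e \<noteq> f"
    note apart = joined[OF \<open>e \<in> M\<close> \<open>f \<in> M\<close>]
    show "e \<inter> f = {}" "\<not> (\<exists>u\<in>e. \<exists>v\<in>f. {u, v} \<in> uedges G)"
      using apart \<open>e \<noteq> f\<close> by blast+
  qed
qed

lemma induced_matching_subset: "induced_matching G M \<Longrightarrow> M \<subseteq> uedges G"
  by (simp add: induced_matching_def matching_def)

lemma induced_matching_same_edge:
  assumes "induced_matching G M" "{u, v} \<in> M" "{u', v'} \<in> M" "u = u' \<or> {u, u'} \<in> uedges G"
  shows "{u, v} = {u', v'}"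
  using assms(1)[unfolded induced_matching_iff, THEN conjunct2] assms(2-4) by iprover

lemma (in pair_graph) finite_uedges: "finite (uedges G)"
proof -
  have "uedges G = (\<lambda>(u, v). {u, v}) ` parcs G"
    by (auto simp: uedges_def)
  then show ?thesis using pair_finite_arcs by simp
qed

text \<open>The arcs split into disjoint fibres, one per edge, and looplessness gives each fibre
  exactly two elements.\<close>

lemma (in pair_graph) card_arcs_of_edge_set:
  assumes "M \<subseteq> uedges G"
  shows "card {(u, v). {u, v} \<in> M} = 2 * card M"
proof -
  have card2: "card {(u, v). {u, v} = e} = 2" if e_in: "e \<in> M" for e
  proof -
    obtain a b where e: "e = {a, b}" and ab: "(a, b) \<in> parcs G"
      using e_in assms unfolding uedges_def by blast
    have "{(u, v). {u, v} = e} = {(a, b), (b, a)}"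
      by (auto simp: e doubleton_eq_iff)
    moreover have "a \<noteq> b" using no_loops' ab by auto
    ultimately show ?thesis by simp
  qed
  have "{(u, v). {u, v} \<in> M} = (\<Union>e\<in>M. {(u, v). {u, v} = e})" by auto
  \<comment> \<open>An infinite set would have \<open>card\<close> 0, not 2.\<close>
  moreover have "finite {(u, v). {u, v} = e}" if "e \<in> M" for e
    using card2[OF that] card.infinite by fastforce
  moreover have "finite M" using assms finite_uedges finite_subset by blast
  moreover have "card (\<Union>e\<in>M. {(u, v). {u, v} = e}) = (\<Sum>e\<in>M. card {(u, v). {u, v} = e})"
    by (rule card_UN_disjoint) (use calculation in auto)
  ultimately show ?thesis by (simp add: card2)
qed

lemma (in pair_graph) card_le_induced_matching_number:
  assumes "induced_matching G M"
  shows "card M \<le> \<nu>\<^sub>I G"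
  unfolding induced_matching_number_def
  by (rule Max_ge) (use assms finite_induced_matching_cards pair_graph_axioms in blast)+

lemma (in pair_graph) induced_matching_number_attained:
  obtains M where "induced_matching G M" "card M = \<nu>\<^sub>I G"
proof -
  have "\<nu>\<^sub>I G \<in> {card M | M. induced_matching G M}"
    unfolding induced_matching_number_def
    by (rule Max_in) (use induced_matching_empty finite_induced_matching_cards pair_graph_axioms in blast)+
  with that show ?thesis by auto
qed

text \<open>The arcs of a matching have pairwise distinct tails, and there are two arcs per edge.
  This supplies the upper bounds in the sharpness example.\<close>

lemma (in pair_graph) induced_matching_number_le_half_verts:
  "2 * \<nu>\<^sub>I G \<le> card (pverts G)"
proof -
  obtain M where M: "induced_matching G M" "card M = \<nu>\<^sub>I G"
    by (rule induced_matching_number_attained)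
  then have sub: "M \<subseteq> uedges G" by (simp add: induced_matching_subset)
  let ?A = "{(u, v). {u, v} \<in> M}"
  have "inj_on fst ?A"
    using induced_matching_same_edge[OF M(1)] by (fastforce simp: inj_on_def doubleton_eq_iff)
  moreover have "fst ` ?A \<subseteq> pverts G"
  proof clarsimp
    fix u v assume "{u, v} \<in> M"
    with sub have "(u, v) \<in> parcs G" by (auto simp flip: insert_mem_uedges_iff)
    then show "u \<in> pverts G" by (simp add: wellformed')
  qed
  ultimately have "card ?A \<le> card (pverts G)"
    using pair_finite_verts card_inj_on_le by blast
  with M(2) card_arcs_of_edge_set[OF sub] show ?thesis by simp
qed

text \<open>Single edges {a, b} and {c, d} yield the two edges {(a, c), (b, d)} and {(a, d), (b,
  c)}; the full edge sets yield the edge set of the direct product. The defining condition is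
  symmetric in \<open>x\<close> and \<open>y\<close>, hence well defined on unordered pairs.\<close>

definition product_edges :: "'a set set \<Rightarrow> 'b set set \<Rightarrow> ('a \<times> 'b) set set" where
  "product_edges M N = {{x, y} | x y. {fst x, fst y} \<in> M \<and> {snd x, snd y} \<in> N}"

lemma insert_mem_product_edges_iff:
  "{x, y} \<in> product_edges M N \<longleftrightarrow> {fst x, fst y} \<in> M \<and> {snd x, snd y} \<in> N"
proof
  assume "{x, y} \<in> product_edges M N"
  then obtain x' y' where "{x, y} = {x', y'}" "{fst x', fst y'} \<in> M" "{snd x', snd y'} \<in> N"
    unfolding product_edges_def by blast
  then show "{fst x, fst y} \<in> M \<and> {snd x, snd y} \<in> N"
    by (auto simp: doubleton_eq_iff insert_commute)
qed (unfold product_edges_def, blast)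

lemma product_edges_mono:
  "M \<subseteq> M' \<Longrightarrow> N \<subseteq> N' \<Longrightarrow> product_edges M N \<subseteq> product_edges M' N'"
  unfolding product_edges_def by blast

lemma parcs_direct_product_iff:
  "(x, y) \<in> parcs (G \<times>\<^sub>d H) \<longleftrightarrow> (fst x, fst y) \<in> parcs G \<and> (snd x, snd y) \<in> parcs H"
  by (cases x; cases y) (simp add: direct_product_def)

lemma uedges_direct_product:
  assumes "pair_graph G" "pair_graph H"
  shows "uedges (G \<times>\<^sub>d H) = product_edges (uedges G) (uedges H)"
  unfolding product_edges_def uedges_def[of "G \<times>\<^sub>d H"]
  by (simp add: parcs_direct_product_iff pair_graph.insert_mem_uedges_iff assms)

lemma induced_matching_product_edges:
  assumes G: "pair_graph G" and H: "pair_graph H"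
    and M: "induced_matching G M" and N: "induced_matching H N"
  shows "induced_matching (G \<times>\<^sub>d H) (product_edges M N)"
  unfolding induced_matching_iff
proof (intro conjI allI impI)
  show "product_edges M N \<subseteq> uedges (G \<times>\<^sub>d H)"
    by (simp add: uedges_direct_product G H product_edges_mono induced_matching_subset M N)
next
  fix x y x' y'
  assume "{x, y} \<in> product_edges M N" "{x', y'} \<in> product_edges M N"
  then have *: "{fst x, fst y} \<in> M" "{fst x', fst y'} \<in> M" "{snd x, snd y} \<in> N" "{snd x', snd y'} \<in> N"
    by (simp_all add: insert_mem_product_edges_iff)
  assume adj: "x = x' \<or> {x, x'} \<in> uedges (G \<times>\<^sub>d H)"
  then have adj_G: "fst x = fst x' \<or> {fst x, fst x'} \<in> uedges G"
    and adj_H: "snd x = snd x' \<or> {snd x, snd x'} \<in> uedges H"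
    by (auto simp: uedges_direct_product[OF G H] insert_mem_product_edges_iff)
  have eq: "{fst x, fst y} = {fst x', fst y'}" "{snd x, snd y} = {snd x', snd y'}"
    using induced_matching_same_edge[OF M *(1,2) adj_G]
      induced_matching_same_edge[OF N *(3,4) adj_H] .
  \<comment> \<open>Two disjoint product edges project to the same pair of edges, so
    \<open>eq\<close> alone does not suffice. If \<open>x = x'\<close>, both coordinates of
    \<open>y\<close> and \<open>y'\<close> agree. If \<open>x\<close> and \<open>x'\<close> are
    adjacent, they differ in both coordinates, as there are no loops, which forces
    \<open>x' = y\<close> and \<open>y' = x\<close>.\<close>
  from adj show "{x, y} = {x', y'}"
  proof
    assume "x = x'"
    with eq show ?thesis by (auto simp: doubleton_eq_iff prod_eq_iff)
  next
    assume "{x, x'} \<in> uedges (G \<times>\<^sub>d H)"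
    then have "{fst x, fst x'} \<in> uedges G" "{snd x, snd x'} \<in> uedges H"
      by (simp_all add: uedges_direct_product[OF G H] insert_mem_product_edges_iff)
    then have "fst x \<noteq> fst x'" "snd x \<noteq> snd x'"
      using pair_graph.singleton_notin_uedges[OF G, of "fst x"]
        pair_graph.singleton_notin_uedges[OF H, of "snd x"] by auto
    with eq show ?thesis by (auto simp: doubleton_eq_iff prod_eq_iff)
  qed
qed

lemma card_product_edges:
  assumes G: "pair_graph G" and H: "pair_graph H"
    and M: "M \<subseteq> uedges G" and N: "N \<subseteq> uedges H"
  shows "card (product_edges M N) = 2 * card M * card N"
proof -
  let ?A = "\<lambda>E. {(u, v). {u, v} \<in> E}"
  \<comment> \<open>Regrouping coordinates turns a pair of arcs into a product arc, so arc counts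
    multiply; halving leaves the factor 2.\<close>
  have "bij_betw (\<lambda>((a, b), (c, d)). ((a, c), (b, d))) (?A M \<times> ?A N) (?A (product_edges M N))"
    by (rule bij_betw_byWitness[where f' = "\<lambda>((a, c), (b, d)). ((a, b), (c, d))"])
      (auto simp: insert_mem_product_edges_iff)
  then have "card (?A (product_edges M N)) = card (?A M) * card (?A N)"
    by (simp flip: bij_betw_same_card add: card_cartesian_product)
  moreover have "product_edges M N \<subseteq> uedges (G \<times>\<^sub>d H)"
    by (simp add: uedges_direct_product G H product_edges_mono M N)
  ultimately show ?thesis
    using pair_graph.card_arcs_of_edge_set[OF G M] pair_graph.card_arcs_of_edge_set[OF H N]
      pair_graph.card_arcs_of_edge_set[OF pair_graph_direct_product[OF G H]] by simp
qed

lemma induced_matching_number_direct_product_ge: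
  assumes G: "pair_graph G" and H: "pair_graph H"
  shows "2 * \<nu>\<^sub>I G * \<nu>\<^sub>I H \<le> \<nu>\<^sub>I (G \<times>\<^sub>d H)"
proof -
  obtain M where M: "induced_matching G M" "card M = \<nu>\<^sub>I G"
    by (rule pair_graph.induced_matching_number_attained[OF G])
  obtain N where N: "induced_matching H N" "card N = \<nu>\<^sub>I H"
    by (rule pair_graph.induced_matching_number_attained[OF H])
  have "card (product_edges M N) = 2 * \<nu>\<^sub>I G * \<nu>\<^sub>I H"
    using card_product_edges[OF G H] M N by (simp add: induced_matching_subset)
  with pair_graph.card_le_induced_matching_number[OF pair_graph_direct_product[OF G H]
      induced_matching_product_edges[OF G H M(1) N(1)]]
  show ?thesis by simp
qed

definition K2 :: "nat pair_pre_digraph" where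
  "K2 = \<lparr>pverts = {0, 1}, parcs = {(0, 1), (1, 0)}\<rparr>"

lemma pair_graph_K2: "pair_graph K2"
  by unfold_locales (auto simp: K2_def symmetric_def intro!: symI)

lemma induced_matching_number_K2: "\<nu>\<^sub>I K2 = 1"
proof (rule antisym)
  show "\<nu>\<^sub>I K2 \<le> 1"
    using pair_graph.induced_matching_number_le_half_verts[OF pair_graph_K2] by (simp add: K2_def)
  have "induced_matching K2 {{0, 1}}"
    by (auto simp: induced_matching_def matching_def uedges_def K2_def)
  from pair_graph.card_le_induced_matching_number[OF pair_graph_K2 this]
  show "1 \<le> \<nu>\<^sub>I K2" by simp
qed

text \<open>The product has four vertices, hence at most two matching edges; the general bound
  already provides two.\<close>

lemma induced_matching_number_K2_K2: "\<nu>\<^sub>I (K2 \<times>\<^sub>d K2) = 2 * \<nu>\<^sub>I K2 * \<nu>\<^sub>I K2"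
proof (rule antisym)
  have "2 * \<nu>\<^sub>I (K2 \<times>\<^sub>d K2) \<le> card (pverts (K2 \<times>\<^sub>d K2))"
    by (intro pair_graph.induced_matching_number_le_half_verts pair_graph_direct_product
        pair_graph_K2)
  also have "\<dots> = 4"
    by (simp add: direct_product_def K2_def card_cartesian_product)
  finally show "\<nu>\<^sub>I (K2 \<times>\<^sub>d K2) \<le> 2 * \<nu>\<^sub>I K2 * \<nu>\<^sub>I K2"
    by (simp add: induced_matching_number_K2)
qed (intro induced_matching_number_direct_product_ge pair_graph_K2)

theorem theorem4p1:
  shows "(\<forall>(G :: 'a pair_pre_digraph) (H :: 'b pair_pre_digraph).
            pair_graph G \<longrightarrow> pair_graph H \<longrightarrow> \<nu>\<^sub>I (G \<times>\<^sub>d H) \<ge> 2 * \<nu>\<^sub>I G * \<nu>\<^sub>I H)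
       \<and> (\<exists>(G :: nat pair_pre_digraph) (H :: nat pair_pre_digraph).
            pair_graph G \<and> pair_graph H \<and> \<nu>\<^sub>I (G \<times>\<^sub>d H) = 2 * \<nu>\<^sub>I G * \<nu>\<^sub>I H)"
  using induced_matching_number_direct_product_ge pair_graph_K2 induced_matching_number_K2_K2
  by blast

end
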